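(* Up to isomorphism, there are exactly 25 Frobenius objects in $\mathbf{Rel}$ whose underlying set has three elements. Writing the set as $X=\{a,b,c\}$, they are the following (pairwise non-isomorphic) structures; in all of them $\tilde\mu$ is symmetric, $\tilde\mu(x,y)=\tilde\mu(y,x)$. Cases 1–20 have unit $\eta=\{a\}$, so $\tilde\mu(a,x)=\tilde\mu(x,a)=\{x\}$ for all $x$, and the remaining values $(\tilde\mu(b,b),\ \tilde\mu(b,c)=\tilde\mu(c,b),\ \tilde\mu(c,c))$ and counit are: 1: $\varepsilon=\{a\}$; $(\{a\},\{c\},\{a,b\})$. 2: $\varepsilon=\{a\}$; $(\{a\},\{c\},\{a,b,c\})$. 3: $\varepsilon=\{a\}$; $(\{a,b\},\{c\},\{a,b\})$. 4: $\varepsilon=\{a\}$; $(\{a,b\},\{c\},\{a,b,c\})$. 5: $\varepsilon=\{a\}$; $(\{a,c\},\{b,c\},\{a,b\})$. 6: $\varepsilon=\{a\}$; $(\{a,c\},\{b,c\},\{a,b,c\})$. 7: $\varepsilon=\{a\}$; $(\{a,b,c\},\{b,c\},\{a,b,c\})$. 8: $\varepsilon=\{a\}$; $(\{b\},\{a,b,c\},\{b,c\})$. 9: $\varepsilon=\{a\}$; $(\{b\},\{a,b,c\},\{c\})$. 10: $\varepsilon=\{a\}$; $(\{c\},\{a\},\{b\})$. 11: $\varepsilon=\{a\}$; $(\{c\},\{a,b\},\{b,c\})$. 12: $\varepsilon=\{a\}$; $(\{b,c\},\{a,b,c\},\{b,c\})$. 13: $\varepsilon=\{b\}$; $(\emptyset,\emptyset,\{b\})$.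 14: $\varepsilon=\{b\}$; $(\emptyset,\emptyset,\{b,c\})$. 15: $\varepsilon=\{b\}$; $(\{a\},\{c\},\{a,b\})$. 16: $\varepsilon=\{b\}$; $(\{a\},\{c\},\{a,b,c\})$. 17: $\varepsilon=\{b\}$; $(\{c\},\{a\},\{b\})$. 18: $\varepsilon=\{b\}$; $(\{c\},\{a,c\},\{a,b,c\})$. 19: $\varepsilon=\{b\}$; $(\{a,c\},\{a,c\},\{a,b\})$. 20: $\varepsilon=\{b\}$; $(\{a,c\},\{a,c\},\{a,b,c\})$. Cases 21–24 have unit $\eta=\{a,b\}$ and $\tilde\mu(a,a)=\{a\}$, $\tilde\mu(a,b)=\tilde\mu(b,a)=\tilde\mu(a,c)=\tilde\mu(c,a)=\emptyset$, $\tilde\mu(b,b)=\{b\}$, $\tilde\mu(b,c)=\tilde\mu(c,b)=\{c\}$, with: 21: $\varepsilon=\{a,b\}$, $\tilde\mu(c,c)=\{b\}$. 22: $\varepsilon=\{a,b\}$, $\tilde\mu(c,c)=\{b,c\}$. 23: $\varepsilon=\{a,c\}$, $\tilde\mu(c,c)=\{b\}$. 24: $\varepsilon=\{a,c\}$, $\tilde\mu(c,c)=\emptyset$. Case 25: $\eta=\varepsilon=\{a,b,c\}$, $\tilde\mu(x,x)=\{x\}$ for each $x$, and $\tilde\mu(x,y)=\emptyset$ for $x\ne y$.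
   Context: $\mathbf{Rel}$ is the monoidal category whose objects are sets, morphisms $X\to Y$ are relations $R\subseteq X\times Y$, composition is $S\circ R=\{(x,z):\exists y,(x,y)\in R,(y,z)\in S\}$, identities are diagonals, the monoidal product is the Cartesian product and the unit is $\{\bullet\}$. A relation $R\subseteq X\times Y$ is identified with $\tilde R:X\to\mathcal{P}(Y)$, $\tilde R(x)=\{y:(x,y)\in R\}$. A Frobenius object in $\mathbf{Rel}$ is a set $X$ with unit $\eta\subseteq X$ (relation $\{\bullet\}\to X$), counit $\varepsilon\subseteq X$ (relation $X\to\{\bullet\}$) and multiplication $\mu\subseteq X\times X\times X$ (relation $X\times X\to X$, described by $\tilde\mu:X\times X\to\mathcal{P}(X)$) satisfying unitality $\mu\circ(\mathbf{1}\times\eta)=\mu\circ(\eta\times\mathbf{1})=\mathbf{1}$, associativity $\mu\circ(\mathbf{1}\times\mu)=\mu\circ(\mu\times\mathbf{1})$, and nondegeneracy: there exists a relation $\beta:\{\bullet\}\to X\times X$ with $(\varepsilon\times\mathbf{1})\circ(\mu\times\mathbf{1})\circ(\mathbf{1}\times\beta)=(\mathbf{1}\times\varepsilon)\circ(\mathbf{1}\times\mu)\circ(\beta\times\mathbf{1})=\mathbf{1}$. An isomorphism between Frobenius objects $(X,\eta,\varepsilon,\tilde\mu)$ and $(X',\eta',\varepsilon',\tilde\mu')$ is a bijection $f:X\to X'$ with $f(\eta)=\eta'$, $f(\varepsilon)=\varepsilon'$ and $\tilde\mu'(f(x),f(y))=f(\tilde\mu(x,y))$ for all $x,y$. *)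

theory Defs
  imports Main
begin

text \<open>Frobenius objects in Rel, with all relational composites written out.
  A Frobenius object has underlying set X :: 'a set, unit eta \<subseteq> X (relation {*} -> X),
  counit eps \<subseteq> X (relation X -> {*}) and multiplication given by
  mu :: 'a \<Rightarrow> 'a \<Rightarrow> 'a set (the function mu-tilde, values inside X for arguments in X).\<close>

definition frobenius_rel :: "'a set \<Rightarrow> 'a set \<Rightarrow> 'a set \<Rightarrow> ('a \<Rightarrow> 'a \<Rightarrow> 'a set) \<Rightarrow> bool" where
  "frobenius_rel X eta eps mu \<longleftrightarrow>
     eta \<subseteq> X \<and> eps \<subseteq> X \<and> (\<forall>x\<in>X. \<forall>y\<in>X. mu x y \<subseteq> X) \<and>
     \<comment> \<open>unitality: mu o (1 x eta) = 1 and mu o (eta x 1) = 1\<close>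
     (\<forall>x\<in>X. (\<Union>e\<in>eta. mu x e) = {x}) \<and>
     (\<forall>x\<in>X. (\<Union>e\<in>eta. mu e x) = {x}) \<and>
     \<comment> \<open>associativity: mu o (1 x mu) = mu o (mu x 1)\<close>
     (\<forall>x\<in>X. \<forall>y\<in>X. \<forall>z\<in>X. (\<Union>w\<in>mu y z. mu x w) = (\<Union>w\<in>mu x y. mu w z)) \<and>
     \<comment> \<open>nondegeneracy: some beta : {*} -> X x X satisfying both snake equations\<close>
     (\<exists>beta \<subseteq> X \<times> X.
        {(x, v). x \<in> X \<and> (\<exists>u. (u, v) \<in> beta \<and> mu x u \<inter> eps \<noteq> {})} = Id_on X \<and>
        {(x, u). x \<in> X \<and> (\<exists>v. (u, v) \<in> beta \<and> mu v x \<inter> eps \<noteq> {})} = Id_on X)"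

text \<open>Isomorphism of Frobenius objects: a bijection preserving unit, counit, multiplication.\<close>
definition frobenius_iso ::
  "('a \<Rightarrow> 'b) \<Rightarrow> 'a set \<Rightarrow> 'a set \<Rightarrow> 'a set \<Rightarrow> ('a \<Rightarrow> 'a \<Rightarrow> 'a set)
   \<Rightarrow> 'b set \<Rightarrow> 'b set \<Rightarrow> 'b set \<Rightarrow> ('b \<Rightarrow> 'b \<Rightarrow> 'b set) \<Rightarrow> bool" where
  "frobenius_iso f X eta eps mu X' eta' eps' mu' \<longleftrightarrow>
     bij_betw f X X' \<and> f ` eta = eta' \<and> f ` eps = eps' \<and>
     (\<forall>x\<in>X. \<forall>y\<in>X. mu' (f x) (f y) = f ` (mu x y))"

definition frobenius_isomorphic ::
  "'a set \<Rightarrow> 'a set \<Rightarrow> 'a set \<Rightarrow> ('a \<Rightarrow> 'a \<Rightarrow> 'a set)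
   \<Rightarrow> 'b set \<Rightarrow> 'b set \<Rightarrow> 'b set \<Rightarrow> ('b \<Rightarrow> 'b \<Rightarrow> 'b set) \<Rightarrow> bool" where
  "frobenius_isomorphic X eta eps mu X' eta' eps' mu' \<longleftrightarrow>
     (\<exists>f. frobenius_iso f X eta eps mu X' eta' eps' mu')"

text \<open>The three-element set {a,b,c}.\<close>
datatype abc = a | b | c

text \<open>Cases 1--20: unit {a}; bb = mu(b,b), bc = mu(b,c) = mu(c,b), cc = mu(c,c).\<close>
definition muA :: "abc set \<Rightarrow> abc set \<Rightarrow> abc set \<Rightarrow> abc \<Rightarrow> abc \<Rightarrow> abc set" where
  "muA bb bc cc x y =
     (if x = a then {y} else if y = a then {x}
      else if x = b \<and> y = b then bb else if x = c \<and> y = c then cc else bc)"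

text \<open>Cases 21--24: unit {a,b}.\<close>
definition muAB :: "abc set \<Rightarrow> abc \<Rightarrow> abc \<Rightarrow> abc set" where
  "muAB cc x y =
     (if x = a \<and> y = a then {a} else if x = a \<or> y = a then {}
      else if x = b \<and> y = b then {b} else if x = c \<and> y = c then cc else {c})"

text \<open>Case 25.\<close>
definition muDiag :: "abc \<Rightarrow> abc \<Rightarrow> abc set" where
  "muDiag x y = (if x = y then {x} else {})"

text \<open>The list of the 25 structures (unit, counit, multiplication); list index i is case i+1.\<close>
definition frob_cases :: "(abc set \<times> abc set \<times> (abc \<Rightarrow> abc \<Rightarrow> abc set)) list" where
  "frob_cases = [
     ({a}, {a}, muA {a} {c} {a,b}),
     ({a}, {a}, muA {a} {c} {a,b,c}),
     ({a}, {a}, muA {a,b} {c} {a,b}),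
     ({a}, {a}, muA {a,b} {c} {a,b,c}),
     ({a}, {a}, muA {a,c} {b,c} {a,b}),
     ({a}, {a}, muA {a,c} {b,c} {a,b,c}),
     ({a}, {a}, muA {a,b,c} {b,c} {a,b,c}),
     ({a}, {a}, muA {b} {a,b,c} {b,c}),
     ({a}, {a}, muA {b} {a,b,c} {c}),
     ({a}, {a}, muA {c} {a} {b}),
     ({a}, {a}, muA {c} {a,b} {b,c}),
     ({a}, {a}, muA {b,c} {a,b,c} {b,c}),
     ({a}, {b}, muA {} {} {b}),
     ({a}, {b}, muA {} {} {b,c}),
     ({a}, {b}, muA {a} {c} {a,b}),
     ({a}, {b}, muA {a} {c} {a,b,c}),
     ({a}, {b}, muA {c} {a} {b}),
     ({a}, {b}, muA {c} {a,c} {a,b,c}),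
     ({a}, {b}, muA {a,c} {a,c} {a,b}),
     ({a}, {b}, muA {a,c} {a,c} {a,b,c}),
     ({a,b}, {a,b}, muAB {b}),
     ({a,b}, {a,b}, muAB {b,c}),
     ({a,b}, {a,c}, muAB {b}),
     ({a,b}, {a,c}, muAB {}),
     ({a,b,c}, {a,b,c}, muDiag)]"

end

theory Submission
  imports Defs
begin

text \<open>Writing G x y for "mu x y meets eps", the two snake equations say that G is invertible as a
  boolean matrix, with inverse beta; hence G is a permutation matrix and beta is its transpose. On
  three points the unit may be moved to {a}, {a, b} or {a, b, c} by an isomorphism. Unitality
  then determines most of the multiplication table (and in the first case the row of the unit
  forces a singleton counit), so that only some thirteen thousand candidates remain, which are checked
  exhaustively inside the kernel.\<close>

section \<open>Nondegeneracy as a permutation condition\<close>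

lemma snake_equations_iff:
  "(\<exists>beta \<subseteq> X \<times> X.
      {(x, v). x \<in> X \<and> (\<exists>u. (u, v) \<in> beta \<and> G x u)} = Id_on X \<and>
      {(x, u). x \<in> X \<and> (\<exists>v. (u, v) \<in> beta \<and> G v x)} = Id_on X) \<longleftrightarrow>
   (\<forall>x\<in>X. \<exists>!y. y \<in> X \<and> G x y) \<and> (\<forall>y\<in>X. \<exists>!x. x \<in> X \<and> G x y)" (is "?L \<longleftrightarrow> ?R")
proof
  assume ?L
  then obtain B where B: "B \<subseteq> X \<times> X"
    and eq1: "{(x, v). x \<in> X \<and> (\<exists>u. (u, v) \<in> B \<and> G x u)} = Id_on X"
    and eq2: "{(x, u). x \<in> X \<and> (\<exists>v. (u, v) \<in> B \<and> G v x)} = Id_on X"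
    by blast
  have 1: "(\<exists>u. (u, v) \<in> B \<and> G x u) \<longleftrightarrow> v = x" if "x \<in> X" for x v
    using eqset_imp_iff[OF eq1, of "(x, v)"] that by (auto simp: Id_on_iff)
  have 2: "(\<exists>v. (u, v) \<in> B \<and> G v x) \<longleftrightarrow> u = x" if "x \<in> X" for x u
    using eqset_imp_iff[OF eq2, of "(x, u)"] that by (auto simp: Id_on_iff)
  have ex: "\<exists>u\<in>X. (u, x) \<in> B \<and> G x u" if "x \<in> X" for x
    using 1[OF that, of x] B by auto
  have ex': "\<exists>v\<in>X. (x, v) \<in> B \<and> G v x" if "x \<in> X" for x
    using 2[OF that, of x] B by auto
  \<comment> \<open>Choose \<open>u\<close> with \<open>(u, x) \<in> B\<close>. Then
    \<open>x\<close> is a witness in the second snake equation at \<open>y\<close> as well as at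
    \<open>y'\<close>, which forces \<open>u = y\<close> and \<open>u = y'\<close>. The mirror
    argument with the first equation gives \<open>unique'\<close>.\<close>
  have unique: "y = y'" if "x \<in> X" "y \<in> X" "y' \<in> X" "G x y" "G x y'" for x y y'
    using ex[OF that(1)] 2[OF that(2)] 2[OF that(3)] that(4,5) by fast
  have unique': "x = x'" if "x \<in> X" "x' \<in> X" "y \<in> X" "G x y" "G x' y" for x x' y
    using ex'[OF that(3)] 1[OF that(1)] 1[OF that(2)] that(4,5) by fast
  show ?R
  proof (intro conjI ballI ex_ex1I)
    show "\<exists>y. y \<in> X \<and> G x y" if "x \<in> X" for x
      using ex[OF that] by blast
    show "\<exists>x. x \<in> X \<and> G x y" if "y \<in> X" for y
      using ex'[OF that] by blast
  qed (use unique unique' in blast)+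
next
  assume R: ?R
  define B where "B = {(y, x). x \<in> X \<and> y \<in> X \<and> G x y}"
  have "B \<subseteq> X \<times> X"
    by (auto simp: B_def)
  moreover have "x \<in> X \<and> (\<exists>u. (u, v) \<in> B \<and> G x u) \<longleftrightarrow> (x, v) \<in> Id_on X" for x v
    using R by (simp add: B_def Id_on_iff) blast
  moreover have "x \<in> X \<and> (\<exists>v. (u, v) \<in> B \<and> G v x) \<longleftrightarrow> (x, u) \<in> Id_on X" for x u
    using R by (simp add: B_def Id_on_iff) blast
  ultimately show ?L
    by (intro exI[of _ B]) auto
qed

text \<open>Eliminates the quantifier over \<open>beta\<close>: the axioms become conditions on
  \<open>eta\<close>, \<open>eps\<close> and \<open>mu\<close> alone, which pass easily along
  bijections and can be evaluated on a finite set.\<close>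

lemma frobenius_rel_iff:
  "frobenius_rel X eta eps mu \<longleftrightarrow>
     eta \<subseteq> X \<and> eps \<subseteq> X \<and> (\<forall>x\<in>X. \<forall>y\<in>X. mu x y \<subseteq> X) \<and>
     (\<forall>x\<in>X. (\<Union>e\<in>eta. mu x e) = {x}) \<and>
     (\<forall>x\<in>X. (\<Union>e\<in>eta. mu e x) = {x}) \<and>
     (\<forall>x\<in>X. \<exists>!y. y \<in> X \<and> mu x y \<inter> eps \<noteq> {}) \<and>
     (\<forall>y\<in>X. \<exists>!x. x \<in> X \<and> mu x y \<inter> eps \<noteq> {}) \<and>
     (\<forall>x\<in>X. \<forall>y\<in>X. \<forall>z\<in>X. (\<Union>w\<in>mu y z. mu x w) = (\<Union>w\<in>mu x y. mu w z))"
  unfolding frobenius_rel_def snake_equations_iff[of X "\<lambda>x y. mu x y \<inter> eps \<noteq> {}"]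
  by (simp only: conj_ac)

section \<open>Isomorphisms and transport of structure\<close>

lemma frobenius_iso_trans:
  assumes "frobenius_iso f X eta eps mu X' eta' eps' mu'"
    and "frobenius_iso g X' eta' eps' mu' X'' eta'' eps'' mu''"
  shows "frobenius_iso (g \<circ> f) X eta eps mu X'' eta'' eps'' mu''"
proof -
  have f: "bij_betw f X X'" and g: "bij_betw g X' X''"
    and mu: "\<And>x y. x \<in> X \<Longrightarrow> y \<in> X \<Longrightarrow> mu' (f x) (f y) = f ` mu x y"
      "\<And>x y. x \<in> X' \<Longrightarrow> y \<in> X' \<Longrightarrow> mu'' (g x) (g y) = g ` mu' x y"
    and "eta'' = g ` f ` eta" "eps'' = g ` f ` eps"
    using assms unfolding frobenius_iso_def by auto
  moreover have "mu'' ((g \<circ> f) x) ((g \<circ> f) y) = (g \<circ> f) ` mu x y" if "x \<in> X" "y \<in> X" for x y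
    using mu that bij_betwE[OF f] by (simp add: image_image)
  ultimately show ?thesis
    unfolding frobenius_iso_def using bij_betw_trans[OF f g] by (simp add: image_comp)
qed

text \<open>Carries the two permutation conditions of \<open>frobenius_rel_iff\<close> across an
  isomorphism.\<close>

lemma Ex1_bij_betw:
  assumes "bij_betw f X X'"
  shows "(\<exists>!y. y \<in> X' \<and> P y) \<longleftrightarrow> (\<exists>!x. x \<in> X \<and> P (f x))"
proof -
  have X': "X' = f ` X" and inj: "inj_on f X"
    using assms by (auto simp: bij_betw_def)
  show ?thesis
    unfolding X'
  proof
    assume "\<exists>!y. y \<in> f ` X \<and> P y"
    then obtain y where "y \<in> f ` X" "P y" and unique: "\<And>y'. y' \<in> f ` X \<Longrightarrow> P y' \<Longrightarrow> y' = y"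
      by (elim ex1E conjE) blast
    then obtain x where x: "x \<in> X" "P (f x)" "f x = y"
      by blast
    have "x' = x" if "x' \<in> X" "P (f x')" for x'
      using inj_onD[OF inj, of x' x] unique[of "f x'"] x that by simp
    with x show "\<exists>!x. x \<in> X \<and> P (f x)"
      by blast
  next
    assume "\<exists>!x. x \<in> X \<and> P (f x)"
    then show "\<exists>!y. y \<in> f ` X \<and> P y"
      by (elim ex1E) auto
  qed
qed

lemma frobenius_rel_iso:
  assumes iso: "frobenius_iso f X eta eps mu X' eta' eps' mu'"
    and rel: "frobenius_rel X eta eps mu"
  shows "frobenius_rel X' eta' eps' mu'"
proof -
  have bij: "bij_betw f X X'" and X': "X' = f ` X"
    and eta': "eta' = f ` eta" and eps': "eps' = f ` eps"
    and mu': "\<And>x y. x \<in> X \<Longrightarrow> y \<in> X \<Longrightarrow> mu' (f x) (f y) = f ` mu x y"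
    using iso by (auto simp: frobenius_iso_def bij_betw_def)
  have inj: "inj_on f X"
    using bij by (simp add: bij_betw_def)
  have sub: "eta \<subseteq> X" "eps \<subseteq> X" and mu: "\<And>x y. x \<in> X \<Longrightarrow> y \<in> X \<Longrightarrow> mu x y \<subseteq> X"
    and unit: "\<And>x. x \<in> X \<Longrightarrow> (\<Union>e\<in>eta. mu x e) = {x}" "\<And>x. x \<in> X \<Longrightarrow> (\<Union>e\<in>eta. mu e x) = {x}"
    and ex1: "\<And>x. x \<in> X \<Longrightarrow> \<exists>!y. y \<in> X \<and> mu x y \<inter> eps \<noteq> {}"
      "\<And>y. y \<in> X \<Longrightarrow> \<exists>!x. x \<in> X \<and> mu x y \<inter> eps \<noteq> {}"
    and assoc: "\<And>x y z. x \<in> X \<Longrightarrow> y \<in> X \<Longrightarrow> z \<in> X \<Longrightarrow>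
      (\<Union>w\<in>mu y z. mu x w) = (\<Union>w\<in>mu x y. mu w z)"
    using rel unfolding frobenius_rel_iff by auto
  \<comment> \<open>An injective map commutes with intersections, so whether a product meets the
    counit is invariant.\<close>
  have pairing: "mu' (f x) (f y) \<inter> eps' \<noteq> {} \<longleftrightarrow> mu x y \<inter> eps \<noteq> {}" if "x \<in> X" "y \<in> X" for x y
    using inj_on_image_Int[OF inj mu[OF that] sub(2)] that by (simp add: mu' eps' flip: image_is_empty[of f])
  \<comment> \<open>Relational composites are unions over intermediate points; this commutation with
    \<open>f\<close> serves the unit laws and both sides of associativity.\<close>
  have UN: "(\<Union>w\<in>f ` A. g w) = f ` (\<Union>w\<in>A. h w)" if "\<And>w. w \<in> A \<Longrightarrow> g (f w) = f ` h w" for A g h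
    using that by auto
  show ?thesis
    unfolding frobenius_rel_iff
  proof (intro conjI)
    show "eta' \<subseteq> X'" "eps' \<subseteq> X'" "\<forall>x\<in>X'. \<forall>y\<in>X'. mu' x y \<subseteq> X'"
      using sub mu by (simp_all add: X' eta' eps' mu' image_mono)
    have "(\<Union>e\<in>eta'. mu' (f x) e) = {f x}" "(\<Union>e\<in>eta'. mu' e (f x)) = {f x}" if "x \<in> X" for x
      using unit[OF that] UN[of eta "mu' (f x)" "mu x"] UN[of eta "\<lambda>e. mu' e (f x)" "\<lambda>e. mu e x"]
        sub that by (auto simp: mu' eta' subset_iff)
    then show "\<forall>x\<in>X'. (\<Union>e\<in>eta'. mu' x e) = {x}" "\<forall>x\<in>X'. (\<Union>e\<in>eta'. mu' e x) = {x}"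
      by (auto simp: X')
    show "\<forall>x\<in>X'. \<exists>!y. y \<in> X' \<and> mu' x y \<inter> eps' \<noteq> {}"
      "\<forall>y\<in>X'. \<exists>!x. x \<in> X' \<and> mu' x y \<inter> eps' \<noteq> {}"
      unfolding Ex1_bij_betw[OF bij] using ex1 pairing by (auto simp: X' cong: conj_cong)
    have "(\<Union>w\<in>mu' (f y) (f z). mu' (f x) w) = (\<Union>w\<in>mu' (f x) (f y). mu' w (f z))"
      if "x \<in> X" "y \<in> X" "z \<in> X" for x y z
    proof -
      have "(\<Union>w\<in>mu' (f y) (f z). mu' (f x) w) = f ` (\<Union>w\<in>mu y z. mu x w)"
        unfolding mu'[OF that(2,3)] using mu[OF that(2,3)] that by (intro UN) (auto simp: mu')
      also have "\<dots> = f ` (\<Union>w\<in>mu x y. mu w z)"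
        by (simp only: assoc[OF that])
      also have "\<dots> = (\<Union>w\<in>mu' (f x) (f y). mu' w (f z))"
        unfolding mu'[OF that(1,2)] using mu[OF that(1,2)] that by (intro UN[symmetric]) (auto simp: mu')
      finally show ?thesis .
    qed
    then show "\<forall>x\<in>X'. \<forall>y\<in>X'. \<forall>z\<in>X'. (\<Union>w\<in>mu' y z. mu' x w) = (\<Union>w\<in>mu' x y. mu' w z)"
      by (simp add: X')
  qed
qed

lemma frobenius_iso_transport:
  assumes "bij_betw g X Y" "frobenius_rel X eta eps mu"
  shows "frobenius_iso g X eta eps mu Y (g ` eta) (g ` eps)
    (\<lambda>x y. g ` mu (the_inv_into X g x) (the_inv_into X g y))"
  using assms by (auto simp: frobenius_iso_def bij_betw_def the_inv_into_f_f)

section \<open>Executable forms of the axioms and of isomorphism\<close>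

instantiation abc :: enum
begin

text \<open>Makes quantifiers over \<open>abc\<close>, and through the instance for sets also those
  over \<open>abc set\<close>, finite and hence computable.\<close>

definition "enum_abc = [a, b, c]"
definition "enum_all_abc P \<longleftrightarrow> P a \<and> P b \<and> P c"
definition "enum_ex_abc P \<longleftrightarrow> P a \<or> P b \<or> P c"

instance
proof
  show UNIV: "(UNIV :: abc set) = set enum_class.enum"
    using abc.exhaust by (auto simp: enum_abc_def)
  show "distinct (enum_class.enum :: abc list)"
    by (simp add: enum_abc_def)
  fix P :: "abc \<Rightarrow> bool"
  show "enum_class.enum_all P \<longleftrightarrow> Ball UNIV P" "enum_class.enum_ex P \<longleftrightarrow> Bex UNIV P"
    unfolding UNIV by (simp_all add: enum_abc_def enum_all_abc_def enum_ex_abc_def)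
qed

end

text \<open>The pairing conditions come first because they reject most tables, and \<open>code_simp\<close> evaluates
  conjunctions and disjunctions (but not implications) lazily from the left.\<close>

definition frobenius_check :: "abc set \<Rightarrow> abc set \<Rightarrow> (abc \<Rightarrow> abc \<Rightarrow> abc set) \<Rightarrow> bool" where
  "frobenius_check eta eps mu \<longleftrightarrow>
     (\<forall>x. \<exists>!y. \<exists>v\<in>eps. v \<in> mu x y) \<and>
     (\<forall>y. \<exists>!x. \<exists>v\<in>eps. v \<in> mu x y) \<and>
     (\<forall>x v. (\<exists>e\<in>eta. v \<in> mu x e) \<longleftrightarrow> v = x) \<and>
     (\<forall>x v. (\<exists>e\<in>eta. v \<in> mu e x) \<longleftrightarrow> v = x) \<and>
     (\<forall>x y z v. (\<exists>w\<in>mu y z. v \<in> mu x w) \<longleftrightarrow> (\<exists>w\<in>mu x y. v \<in> mu w z))"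

lemma frobenius_rel_UNIV_iff: "frobenius_rel UNIV eta eps mu \<longleftrightarrow> frobenius_check eta eps mu"
proof -
  have "mu x y \<inter> eps \<noteq> {} \<longleftrightarrow> (\<exists>v\<in>eps. v \<in> mu x y)" for x y
    by blast
  moreover have "(\<Union>e\<in>A. f e) = {x} \<longleftrightarrow> (\<forall>v. (\<exists>e\<in>A. v \<in> f e) \<longleftrightarrow> v = x)" for A and x :: abc and f :: "abc \<Rightarrow> abc set"
    by (simp add: set_eq_iff)
  moreover have "(\<Union>w\<in>A. f w) = (\<Union>w\<in>B. g w) \<longleftrightarrow> (\<forall>v. (\<exists>w\<in>A. v \<in> f w) \<longleftrightarrow> (\<exists>w\<in>B. v \<in> g w))"
    for A B :: "abc set" and f g :: "abc \<Rightarrow> abc set"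
    by (simp add: set_eq_iff)
  ultimately show ?thesis
    unfolding frobenius_rel_iff frobenius_check_def by (simp only: UNIV_I subset_UNIV ball_UNIV simp_thms conj_ac)
qed

text \<open>A self-map of \<open>abc\<close> is encoded by its three values as
  \<open>case_abc p q r\<close>, and distinctness of the values stands for bijectivity. The search
  thus runs over 27 triples instead of over functions.\<close>

definition iso_check :: "abc set \<times> abc set \<times> (abc \<Rightarrow> abc \<Rightarrow> abc set) \<Rightarrow>
    abc set \<times> abc set \<times> (abc \<Rightarrow> abc \<Rightarrow> abc set) \<Rightarrow> bool" where
  "iso_check S S' \<longleftrightarrow> (case (S, S') of ((eta, eps, mu), (eta', eps', mu')) \<Rightarrow>
     \<exists>p q r. p \<noteq> q \<and> p \<noteq> r \<and> q \<noteq> r \<and> case_abc p q r ` eta = eta' \<and> case_abc p q r ` eps = eps' \<and>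
       (\<forall>x y. mu' (case_abc p q r x) (case_abc p q r y) = case_abc p q r ` mu x y))"

lemma all_abc: "(\<forall>x. P x) \<longleftrightarrow> P a \<and> P b \<and> P c"
  by (metis abc.exhaust)

lemma bij_case_abc:
  fixes p q r :: abc
  shows "bij (case_abc p q r) \<longleftrightarrow> p \<noteq> q \<and> p \<noteq> r \<and> q \<noteq> r"
proof -
  have "bij (case_abc p q r) \<longleftrightarrow> inj (case_abc p q r)"
    using finite_UNIV_inj_surj[of "case_abc p q r"] by (auto simp: bij_def)
  also have "\<dots> \<longleftrightarrow> p \<noteq> q \<and> p \<noteq> r \<and> q \<noteq> r"
    by (simp add: inj_def all_abc) blast
  finally show ?thesis .
qed

lemma isomorphic_UNIV_iff:
  "frobenius_isomorphic UNIV eta eps mu UNIV eta' eps' mu' \<longleftrightarrow> iso_check (eta, eps, mu) (eta', eps', mu')"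
proof -
  have "f = case_abc (f a) (f b) (f c)" for f :: "abc \<Rightarrow> abc"
    by (simp add: fun_eq_iff split: abc.split)
  then have "(\<exists>f :: abc \<Rightarrow> abc. P f) \<longleftrightarrow> (\<exists>p q r. P (case_abc p q r))" for P
    by metis
  then show ?thesis
    unfolding frobenius_isomorphic_def frobenius_iso_def iso_check_def
    by (simp add: bij_case_abc)
qed

section \<open>The exhaustive checks\<close>

definition table :: "'c \<Rightarrow> 'c \<Rightarrow> 'c \<Rightarrow> 'c \<Rightarrow> 'c \<Rightarrow> 'c \<Rightarrow> 'c \<Rightarrow> 'c \<Rightarrow> 'c \<Rightarrow> abc \<Rightarrow> abc \<Rightarrow> 'c" where
  "table aa ab ac ba bb bc ca cb cc =
     case_abc (case_abc aa ab ac) (case_abc ba bb bc) (case_abc ca cb cc)"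

definition listed :: "abc set \<Rightarrow> abc set \<Rightarrow> (abc \<Rightarrow> abc \<Rightarrow> abc set) \<Rightarrow> bool" where
  "listed eta eps mu \<longleftrightarrow> (\<exists>S\<in>set frob_cases. iso_check (eta, eps, mu) S)"

text \<open>There are 3 * 8^4 = 12288 candidates. Since \<open>bc\<close> and \<open>cb\<close> vary
  independently, symmetry of the multiplication is an outcome of the search.\<close>

lemma singleton_unit_listed:
  "\<forall>e bb bc cb cc. \<not> frobenius_check {a} {e} (table {a} {b} {c} {b} bb bc {c} cb cc) \<or>
     listed {a} {e} (table {a} {b} {c} {b} bb bc {c} cb cc)"
  by code_simp

text \<open>Four entries with two possible values each, an arbitrary \<open>cc\<close> and an
  arbitrary counit give 2^4 * 8^2 = 1024 candidates.\<close>

lemma two_point_unit_listed: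
  "\<forall>ac \<in> {{}, {c}}. \<forall>bc \<in> {{}, {c}}. \<forall>ca \<in> {{}, {c}}. \<forall>cb \<in> {{}, {c}}. \<forall>eps cc.
     \<not> frobenius_check {a, b} eps (table {a} {} ac {} {b} bc ca cb cc) \<or>
     listed {a, b} eps (table {a} {} ac {} {b} bc ca cb cc)"
  by code_simp

lemma full_unit_listed:
  "\<forall>eps. \<not> frobenius_check {a, b, c} eps muDiag \<or>
     listed {a, b, c} eps muDiag"
  by code_simp

lemma frob_cases_frobenius: "\<forall>(eta, eps, mu) \<in> set frob_cases. frobenius_check eta eps mu"
  by code_simp

text \<open>The indices range over a list so that all 625 pairs can be evaluated.\<close>

lemma frob_cases_distinct:
  "\<forall>i \<in> set [0..<25]. \<forall>j \<in> set [0..<25]. \<not> iso_check (frob_cases ! i) (frob_cases ! j) \<or> i = j"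
  by code_simp

text \<open>Permutations act transitively on subsets of a given size, so one representative for each
  nonzero size suffices.\<close>

lemma normalize_unit:
  "\<forall>S. S = {} \<or> (\<exists>p q r. p \<noteq> q \<and> p \<noteq> r \<and> q \<noteq> r \<and> case_abc p q r ` S \<in> {{a}, {a, b}, {a, b, c}})"
  by code_simp

text \<open>Replaces an unknown multiplication by its nine values, so that the checks above quantify
  over subsets and not over functions.\<close>

lemma mu_eq_table:
  "mu = table (mu a a) (mu a b) (mu a c) (mu b a) (mu b b) (mu b c) (mu c a) (mu c b) (mu c c)"
  by (simp add: table_def fun_eq_iff split: abc.split)

section \<open>Constraints imposed by the unit laws\<close>

lemma frobenius_check_unit:
  assumes "frobenius_check eta eps mu"
  shows "(\<exists>e\<in>eta. v \<in> mu x e) \<longleftrightarrow> v = x" "(\<exists>e\<in>eta. v \<in> mu e x) \<longleftrightarrow> v = x"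
  using assms by (simp_all add: frobenius_check_def)

lemma frobenius_check_listed:
  assumes check: "frobenius_check eta eps mu" and eta: "eta \<in> {{a}, {a, b}, {a, b, c}}"
  shows "listed eta eps mu"
proof -
  note unit = frobenius_check_unit[OF check]
  \<comment> \<open>The unit law fixes only the union over all units, so a product with a single
    unit may also be empty.\<close>
  have le: "mu x e \<subseteq> {x}" "mu e x \<subseteq> {x}" if "e \<in> eta" for e x
    using unit[where x = x] that by auto
  consider "eta = {a}" | "eta = {a, b}" | "eta = {a, b, c}"
    using eta by blast
  then show ?thesis
  proof cases
    case 1
    then have mu: "mu x a = {x}" "mu a x = {x}" for x
      using unit[where x = x] by auto
    \<comment> \<open>As \<open>mu a y = {y}\<close>, the elements \<open>y\<close> paired with
      \<open>a\<close> are exactly those of \<open>eps\<close>; uniqueness of the partner makes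
      \<open>eps\<close> a singleton.\<close>
    have "\<exists>!y. \<exists>v\<in>eps. v \<in> mu a y"
      using check by (simp add: frobenius_check_def)
    then obtain e where eps: "eps = {e}"
      unfolding mu by blast
    obtain bb bc cb cc where table: "mu = table {a} {b} {c} {b} bb bc {c} cb cc"
      using mu_eq_table[of mu, unfolded mu] by blast
    show ?thesis
      using check singleton_unit_listed unfolding 1 eps table by blast
  next
    case 2
    then have le2: "mu x a \<subseteq> {x}" "mu x b \<subseteq> {x}" "mu a x \<subseteq> {x}" "mu b x \<subseteq> {x}" for x
      using le by auto
    \<comment> \<open>A product of two distinct units lies in both of their singletons, hence is
      empty; the unit law then leaves only the diagonal product to produce each unit.\<close>
    have off: "mu a b = {}" "mu b a = {}"
      using le2(1)[of b] le2(2)[of a] le2(3)[of b] le2(4)[of a] by auto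
    then have diag: "mu a a = {a}" "mu b b = {b}"
      using unit(1)[where x = a] unit(1)[where x = b] 2 by auto
    have "mu a c \<in> {{}, {c}}" "mu b c \<in> {{}, {c}}" "mu c a \<in> {{}, {c}}" "mu c b \<in> {{}, {c}}"
      using le2[of c] by (auto simp: subset_singleton_iff)
    then obtain ac bc ca cb cc where table: "mu = table {a} {} ac {} {b} bc ca cb cc"
      and mem: "ac \<in> {{}, {c}}" "bc \<in> {{}, {c}}" "ca \<in> {{}, {c}}" "cb \<in> {{}, {c}}"
      by (rule that[OF mu_eq_table[of mu, unfolded off diag]])
    show ?thesis
      using check two_point_unit_listed[THEN bspec, OF mem(1), THEN bspec, OF mem(2), THEN bspec, OF mem(3),
          THEN bspec, OF mem(4), THEN spec, THEN spec, of eps cc]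
      unfolding 2 table by blast
  next
    case 3
    then have "eta = UNIV"
      using abc.exhaust by auto
    \<comment> \<open>Here both factors are always units, so off-diagonal products vanish and the
      unit law fills the diagonal.\<close>
    then have le3: "mu x y \<subseteq> {x} \<inter> {y}" for x y
      using le[of y x] le[of x y] by auto
    have "x \<in> mu x x" for x
      using unit(1)[where x = x and v = x] le3[of x] by blast
    then have "mu x y = muDiag x y" for x y
      using le3[of x y] by (cases "x = y") (auto simp: muDiag_def)
    then have mu: "mu = muDiag"
      by blast
    show ?thesis
      using check full_unit_listed unfolding 3 mu by blast
  qed
qed

section \<open>Arbitrary three-element sets and the classification\<close>

lemma frobenius_rel_card_3:
  assumes "card X = 3" and rel: "frobenius_rel X eta eps mu"
  shows "\<exists>(eta', eps', mu') \<in> set frob_cases. frobenius_isomorphic X eta eps mu UNIV eta' eps' mu'"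
proof -
  have "finite X"
    using \<open>card X = 3\<close> by (metis card.infinite zero_neq_numeral)
  moreover have "card (UNIV :: abc set) = 3"
    by (simp add: card_UNIV_length_enum enum_abc_def)
  ultimately obtain h :: "_ \<Rightarrow> abc" where h: "bij_betw h X UNIV"
    using assms(1) finite_same_card_bij[of X "UNIV :: abc set"] by auto
  have "X \<noteq> {}"
    using \<open>card X = 3\<close> by auto
  \<comment> \<open>With an empty unit, the unit law at a point \<open>x\<close> of \<open>X\<close>
    would read \<open>{} = {x}\<close>.\<close>
  then have "h ` eta \<noteq> {}"
    using rel unfolding frobenius_rel_def by auto
  then obtain p q r where "bij (case_abc p q r)" and unit: "case_abc p q r ` h ` eta \<in> {{a}, {a, b}, {a, b, c}}"
    unfolding bij_case_abc using spec[OF normalize_unit, of "h ` eta"] by blast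
  \<comment> \<open>An arbitrary labelling of \<open>X\<close> by \<open>abc\<close>, followed by a
    relabelling that puts the unit into standard form.\<close>
  define g where "g = case_abc p q r \<circ> h"
  have g: "bij_betw g X UNIV"
    unfolding g_def using h \<open>bij (case_abc p q r)\<close> by (rule bij_betw_trans)
  obtain eps1 mu1 where iso1: "frobenius_iso g X eta eps mu UNIV (g ` eta) eps1 mu1"
    using frobenius_iso_transport[OF g rel] by blast
  have "frobenius_check (g ` eta) eps1 mu1"
    using frobenius_rel_iso[OF iso1 rel] by (simp add: frobenius_rel_UNIV_iff)
  moreover have "g ` eta \<in> {{a}, {a, b}, {a, b, c}}"
    using unit by (simp add: g_def image_comp)
  ultimately have "listed (g ` eta) eps1 mu1"
    by (rule frobenius_check_listed)
  then obtain eta' eps' mu' where mem: "(eta', eps', mu') \<in> set frob_cases"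
    and "iso_check (g ` eta, eps1, mu1) (eta', eps', mu')"
    unfolding listed_def by auto
  then obtain f where "frobenius_iso f UNIV (g ` eta) eps1 mu1 UNIV eta' eps' mu'"
    using isomorphic_UNIV_iff unfolding frobenius_isomorphic_def by blast
  from frobenius_iso_trans[OF iso1 this] mem show ?thesis
    unfolding frobenius_isomorphic_def by blast
qed

theorem theorem6p1:
  shows "length frob_cases = 25 \<and>
    (\<forall>i < 25. case frob_cases ! i of (eta, eps, mu) \<Rightarrow>
        frobenius_rel (UNIV :: abc set) eta eps mu) \<and>
    (\<forall>i < 25. \<forall>j < 25.
        (case frob_cases ! i of (eta, eps, mu) \<Rightarrow>
          case frob_cases ! j of (eta', eps', mu') \<Rightarrow>
            frobenius_isomorphic (UNIV :: abc set) eta eps mu (UNIV :: abc set) eta' eps' mu')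
        \<longrightarrow> i = j) \<and>
    (\<forall>(X :: 'x set) eta eps mu. card X = 3 \<longrightarrow> frobenius_rel X eta eps mu \<longrightarrow>
        (\<exists>i < 25. case frob_cases ! i of (eta', eps', mu') \<Rightarrow>
            frobenius_isomorphic X eta eps mu (UNIV :: abc set) eta' eps' mu'))"
proof (intro conjI allI impI)
  show len: "length frob_cases = 25"
    by (simp add: frob_cases_def)
  fix i :: nat
  assume i: "i < 25"
  show "case frob_cases ! i of (eta, eps, mu) \<Rightarrow> frobenius_rel (UNIV :: abc set) eta eps mu"
    using frob_cases_frobenius i by (simp add: len frobenius_rel_UNIV_iff)
  fix j :: nat
  assume j: "j < 25"
    and "case frob_cases ! i of (eta, eps, mu) \<Rightarrow> case frob_cases ! j of (eta', eps', mu') \<Rightarrow>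
      frobenius_isomorphic (UNIV :: abc set) eta eps mu (UNIV :: abc set) eta' eps' mu'"
  then have "iso_check (frob_cases ! i) (frob_cases ! j)"
    by (simp add: isomorphic_UNIV_iff split: prod.splits)
  with frob_cases_distinct i j show "i = j"
    by (simp add: atLeastLessThan_upt[symmetric])
next
  fix X :: "'x set" and eta eps mu
  assume "card X = 3" "frobenius_rel X eta eps mu"
  then have "\<exists>S \<in> set frob_cases. case S of (eta', eps', mu') \<Rightarrow>
      frobenius_isomorphic X eta eps mu (UNIV :: abc set) eta' eps' mu'"
    by (rule frobenius_rel_card_3)
  moreover have "length frob_cases = 25"
    by (simp add: frob_cases_def)
  ultimately show "\<exists>i < 25. case frob_cases ! i of (eta', eps', mu') \<Rightarrow>
      frobenius_isomorphic X eta eps mu (UNIV :: abc set) eta' eps' mu'"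
    by (metis in_set_conv_nth)
qed

end
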